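(* Let $(V,\|\cdot\|)$ be a normed vector space, let $B_1$ be a unit ball with respect to $\|\cdot\|$, let $\varepsilon>0$, and let $\Theta\subseteq V$ be convex with $\mathrm{diam}(\Theta)\ge 12\varepsilon$. Let $1\le\ell\le k$ be integers and let $m$ be an integer with $m\ge k(N(B_1,1/4)+1)$. Let $\mathcal{F}$ denote the set of deterministic voting rules that take as inputs candidate locations, expert locations, and top $k$ rankings and output a set of $\ell$ candidates. For $f\in\mathcal{F}$, let $n_f$ denote the size of the smallest universal committee of experts in $\Theta$ that guarantees, under $f$, a cumulative regret of at most $\varepsilon$ for any set of $m$ candidates in $\Theta$. Then $$M(\Theta,24\varepsilon/\ell)\left(\frac{m}{k(N(B_1,1/4)+1)}-1\right)\ \le\ \inf_{f\in\mathcal{F}}n_f\ \le\ \begin{cases}\left(\frac{8m}{\ell}\log\left(\frac{k}{k-\ell}\right)+1\right)\bigl(N(\Theta,\varepsilon/(2\ell))-1\bigr) & \text{if } \ell<k,\\[4pt] \left(\frac{8m}{k}(1+\log k)+1\right)\bigl(N(\Theta,\varepsilon/(2\ell))-1\bigr) & \text{if } \ell=k,\end{cases}$$ where all covering and packing numbers are with respect to $\|\cdot\|$.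
   Context: Model. There are $m$ candidates $[m]=\{1,\dots,m\}$; candidate $j$ has a location $c_j\in\Theta$ (locations may coincide) and a quality $q_j\in\mathbb{R}$. A committee is a finite list $E=\{e_1,\dots,e_n\}$ of expert locations in $\Theta$ (its size is $n$); "universal" means that it is fixed before, and independently of, the candidates. Write $d(x,y)=\|x-y\|$. Given the qualities, expert $i$ reports a ranking $\succ_i^k$ of her top $k$ candidates: for $h=1,\dots,k$, $\succ_i^k(h)\in\arg\max_{j\in[m]\setminus\{\succ_i^k(1),\dots,\succ_i^k(h-1)\}}\, q_j-d(e_i,c_j)$, with ties broken arbitrarily. Cumulative regret. A committee $E$ guarantees cumulative regret at most $\varepsilon$ under $f\in\mathcal{F}$ for any set of $m$ candidates if for all candidate locations $C$ in $\Theta$, all $q\in\mathbb{R}^m$ and all rankings $\succ^k=\{\succ_i^k\}_{i\in[n]}$ that arise from $q$ (under any tie-breaking), $\max_{S'\subseteq[m]:|S'|=\ell}\sum_{j\in S'}q_j-\sum_{j\in f(C,E,\succ^k)}q_j\le\varepsilon$. Covering and packing. $N(S,\delta)$ is the minimum size of an (internal) $\delta$-cover of $S$, i.e. a set $X\subseteq S$ such that every $s\in S$ has some $x\in X$ with $\|s-x\|\le\delta$. $M(S,\delta)$ is the maximum size of a $\delta$-packing of $S$, i.e. a set $X\subseteq S$ with $\|x-x'\|\ge\delta$ for all distinct $x,x'\in X$. $\log$ is the natural logarithm. *)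

theory Defs
  imports "HOL-Analysis.Analysis"
begin

text \<open>
  Covering numbers, packing numbers and the diameter take values in \<^typ>\<open>enat\<close> and
  \<^typ>\<open>ereal\<close>, so that they are infinite (rather than junk) for unbounded sets and for balls in
  infinite-dimensional spaces.
\<close>

definition is_cover :: "'a::metric_space set \<Rightarrow> real \<Rightarrow> 'a set \<Rightarrow> bool" where
  "is_cover S \<delta> X \<longleftrightarrow> X \<subseteq> S \<and> (\<forall>s\<in>S. \<exists>x\<in>X. dist s x \<le> \<delta>)"

definition is_packing :: "'a::metric_space set \<Rightarrow> real \<Rightarrow> 'a set \<Rightarrow> bool" where
  "is_packing S \<delta> X \<longleftrightarrow> X \<subseteq> S \<and> (\<forall>x\<in>X. \<forall>x'\<in>X. x \<noteq> x' \<longrightarrow> dist x x' \<ge> \<delta>)"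

definition covering_number :: "'a::metric_space set \<Rightarrow> real \<Rightarrow> enat" where
  "covering_number S \<delta> = (INF X \<in> {X. finite X \<and> is_cover S \<delta> X}. enat (card X))"

text \<open>
  Subsets of packings are packings, so restricting to finite packings still gives the value
  \<open>\<infinity>\<close> when there is an infinite one.
\<close>

definition packing_number :: "'a::metric_space set \<Rightarrow> real \<Rightarrow> enat" where
  "packing_number S \<delta> = (SUP X \<in> {X. finite X \<and> is_packing S \<delta> X}. enat (card X))"

text \<open>The library's \<^const>\<open>diameter\<close> is real-valued and unspecified on unbounded sets.\<close>

definition ediameter :: "'a::metric_space set \<Rightarrow> ereal" where
  "ediameter S = (SUP x\<in>S. SUP y\<in>S. ereal (dist x y))"

text \<open>
  The \<open>m\<close> candidates are \<open>0, \<dots>, m - 1\<close>; their locations form a list \<open>C\<close> of length \<open>m\<close>.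
  A committee is a list \<open>E\<close> of expert locations. Lists are used so that a voting rule sees
  exactly these data: the number of experts, but no values outside the index range.
  A ranking is a list of candidates, most preferred first; \<open>r ! h\<close> is the candidate ranked
  \<open>h + 1\<close>-st, and a ranking profile \<open>R\<close> has one ranking per expert.
\<close>

definition top_ranking ::
  "nat \<Rightarrow> nat \<Rightarrow> 'a::metric_space list \<Rightarrow> (nat \<Rightarrow> real) \<Rightarrow> 'a \<Rightarrow> nat list \<Rightarrow> bool" where
  "top_ranking m k C q e r \<longleftrightarrow> length r = k \<and>
     (\<forall>h<k. is_arg_max (\<lambda>j. q j - dist e (C ! j)) (\<lambda>j. j \<in> {..<m} - set (take h r)) (r ! h))"

definition voting_rules ::
  "'a set \<Rightarrow> nat \<Rightarrow> nat \<Rightarrow> nat \<Rightarrow> ('a list \<Rightarrow> 'a list \<Rightarrow> nat list list \<Rightarrow> nat set) set" where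
  "voting_rules \<Theta> m k l = {f. \<forall>C E R.
     length C = m \<and> set C \<subseteq> \<Theta> \<and> set E \<subseteq> \<Theta> \<and> length R = length E \<and>
     (\<forall>r\<in>set R. length r = k \<and> distinct r \<and> set r \<subseteq> {..<m})
     \<longrightarrow> f C E R \<subseteq> {..<m} \<and> card (f C E R) = l}"

definition cumulative_regret :: "nat \<Rightarrow> nat \<Rightarrow> (nat \<Rightarrow> real) \<Rightarrow> nat set \<Rightarrow> real" where
  "cumulative_regret m l q S =
     (MAX S' \<in> {S'. S' \<subseteq> {..<m} \<and> card S' = l}. \<Sum>j\<in>S'. q j) - (\<Sum>j\<in>S. q j)"

definition guarantees_regret ::
  "'a::metric_space set \<Rightarrow> nat \<Rightarrow> nat \<Rightarrow> nat \<Rightarrow> ('a list \<Rightarrow> 'a list \<Rightarrow> nat list list \<Rightarrow> nat set)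
     \<Rightarrow> real \<Rightarrow> 'a list \<Rightarrow> bool" where
  "guarantees_regret \<Theta> m k l f \<epsilon> E \<longleftrightarrow>
     (\<forall>C q R. length C = m \<and> set C \<subseteq> \<Theta> \<and> list_all2 (top_ranking m k C q) E R
        \<longrightarrow> cumulative_regret m l q (f C E R) \<le> \<epsilon>)"

text \<open>The value is \<open>\<infinity>\<close> if no finite committee achieves the guarantee.\<close>

definition min_committee_size ::
  "'a::metric_space set \<Rightarrow> nat \<Rightarrow> nat \<Rightarrow> nat \<Rightarrow> ('a list \<Rightarrow> 'a list \<Rightarrow> nat list list \<Rightarrow> nat set)
     \<Rightarrow> real \<Rightarrow> enat" where
  "min_committee_size \<Theta> m k l f \<epsilon> =
     (INF E \<in> {E. set E \<subseteq> \<Theta> \<and> guarantees_regret \<Theta> m k l f \<epsilon> E}. enat (length E))"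

end

theory Submission
  imports Defs
begin

text \<open>
  Upper bound. A fine subdivision of a spanning tree of a cover serves as committee. When two
  neighbouring experts order a pair of candidates differently, the quality difference of the pair
  is known up to twice their distance. In the graph of these swapped pairs, every breadth-first
  layer between the top candidates of two experts contains the whole (remaining) report of some
  expert: otherwise the topmost reported candidate outside the layer would have to jump over the
  layer between two neighbours. Hence the number of layers is at most about \<open>m / g\<close> if at least \<open>g\<close>
  reported candidates remain, all top candidates are comparable with a small error, and \<open>l\<close> greedy
  picks accumulate a harmonic sum of such errors.

  Lower bound. A small committee has few experts around some packing point \<open>p\<close>. Put \<open>k\<close> candidates
  at \<open>p\<close>, at each of these experts, and at each of finitely many decoys at distance \<open>12 * \<epsilon> / l\<close> from
  \<open>p\<close>, one for each direction of a cover of the unit ball. Distant experts see only decoys, and the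
  reports do not reveal whether the candidates at \<open>p\<close> are better or worse than the decoys.
\<close>

section \<open>Regret and reports\<close>

lemma sum_le_cumulative_regret:
  assumes "S' \<subseteq> {..<m}" "card S' = l"
  shows "sum q S' - sum q S \<le> cumulative_regret m l q S"
proof -
  have "finite {S'. S' \<subseteq> {..<m} \<and> card S' = l}"
    by (rule finite_subset[of _ "Pow {..<m}"]) auto
  then have "sum q S' \<le> (MAX S' \<in> {S'. S' \<subseteq> {..<m} \<and> card S' = l}. sum q S')"
    using assms by (intro Max_ge) auto
  then show ?thesis unfolding cumulative_regret_def by simp
qed

lemma cumulative_regret_le:
  assumes "l \<le> m"
    and "\<And>S'. S' \<subseteq> {..<m} \<Longrightarrow> card S' = l \<Longrightarrow> sum q S' \<le> sum q S + b"
  shows "cumulative_regret m l q S \<le> b"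
proof -
  define \<A> where "\<A> = {S'. S' \<subseteq> {..<m} \<and> card S' = l}"
  have "finite \<A>"
    unfolding \<A>_def by (rule finite_subset[of _ "Pow {..<m}"]) auto
  moreover have "{..<l} \<in> \<A>"
    using assms(1) unfolding \<A>_def by auto
  moreover have "sum q S' \<le> sum q S + b" if "S' \<in> \<A>" for S'
    using that assms(2) unfolding \<A>_def by auto
  ultimately have "(MAX S' \<in> \<A>. sum q S') \<le> sum q S + b"
    by (intro Max.boundedI) auto
  then show ?thesis unfolding cumulative_regret_def \<A>_def by simp
qed

text \<open>\<open>y\<close> may also be unreported or equal to \<open>z\<close>, so a truncated
  report still yields weak comparisons with every candidate that it omits.\<close>

definition reports_above :: "nat list \<Rightarrow> nat \<Rightarrow> nat \<Rightarrow> bool" where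
  "reports_above r z y \<longleftrightarrow> (\<exists>h<length r. r ! h = z \<and> y \<notin> set (take h r))"

lemma reports_above_adjusted_quality:
  assumes "top_ranking m k C q e r" "y < m" "reports_above r z y"
  shows "q y - dist e (C ! y) \<le> q z - dist e (C ! z)"
  using assms unfolding top_ranking_def reports_above_def is_arg_max_def
  by (metis (no_types, lifting) DiffI lessThan_iff not_le)

lemma top_ranking_in_range:
  assumes "top_ranking m k C q e r"
  shows "set r \<subseteq> {..<m}"
proof
  fix x assume "x \<in> set r"
  then obtain h where "h < length r" "r ! h = x" by (auto simp: in_set_conv_nth)
  then show "x \<in> {..<m}" using assms by (auto simp: top_ranking_def is_arg_max_def)
qed

lemma top_ranking_distinct:
  assumes "top_ranking m k C q e r"
  shows "distinct r"
proof -
  have "r ! i \<noteq> r ! j" if "i < j" "j < length r" for i j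
  proof -
    have "r ! j \<notin> set (take j r)"
      using assms that by (auto simp: top_ranking_def is_arg_max_def)
    moreover have "r ! i \<in> set (take j r)"
      using that by (auto simp: in_set_conv_nth intro!: exI[of _ i])
    ultimately show ?thesis by metis
  qed
  then show ?thesis
    by (metis distinct_conv_nth nat_neq_iff)
qed

lemma reports_above_topmost:
  assumes "set r \<inter> W \<noteq> {}"
  obtains z where "z \<in> W" "z \<in> set r" "\<And>y. y \<in> W \<Longrightarrow> reports_above r z y"
proof -
  have "\<exists>h. h < length r \<and> r ! h \<in> W"
    using assms by (auto simp: in_set_conv_nth)
  then obtain h where h: "h < length r" "r ! h \<in> W"
    and least: "\<And>i. i < h \<Longrightarrow> \<not> (i < length r \<and> r ! i \<in> W)"
    using exists_least_iff[of "\<lambda>h. h < length r \<and> r ! h \<in> W"] by blast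
  have "reports_above r (r ! h) y" if "y \<in> W" for y
    unfolding reports_above_def using h least that
    by (intro exI[of _ h]) (auto simp: in_set_conv_nth)
  then show ?thesis using h that by auto
qed

section \<open>Upper bound\<close>

definition links :: "'a::metric_space set \<Rightarrow> real \<Rightarrow> ('a \<times> 'a) set" where
  "links F s = {(x, y). x \<in> F \<and> y \<in> F \<and> dist x y \<le> s}"

definition observed_swap ::
  "'a::metric_space set \<Rightarrow> ('a \<Rightarrow> nat list) \<Rightarrow> real \<Rightarrow> nat \<Rightarrow> nat \<Rightarrow> bool" where
  "observed_swap F \<rho> s z y \<longleftrightarrow> (\<exists>a\<in>F. \<exists>b\<in>F. dist a b \<le> s \<and>
     reports_above (\<rho> a) z y \<and> reports_above (\<rho> b) y z)"

text \<open>The breadth-first ball of radius \<open>n\<close> around \<open>b\<close> in the swap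
  graph restricted to \<open>U\<close>; differences of consecutive balls are the layers.\<close>

primrec swap_ball ::
  "'a::metric_space set \<Rightarrow> ('a \<Rightarrow> nat list) \<Rightarrow> real \<Rightarrow> nat set \<Rightarrow> nat \<Rightarrow> nat \<Rightarrow> nat set" where
  "swap_ball F \<rho> s U b 0 = {b}"
| "swap_ball F \<rho> s U b (Suc n) =
     swap_ball F \<rho> s U b n \<union> {y \<in> U. \<exists>z\<in>swap_ball F \<rho> s U b n. observed_swap F \<rho> s z y}"

lemma swap_ball_subset: "b \<in> U \<Longrightarrow> swap_ball F \<rho> s U b n \<subseteq> U"
  by (induction n) auto

lemma center_in_swap_ball: "b \<in> swap_ball F \<rho> s U b n"
  by (induction n) auto

text \<open>Two quality vectors with the same reports differ on a swapped pair by at most \<open>2 * s\<close>,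
  because the distances to both candidates change by at most \<open>s\<close> between the two experts.\<close>

lemma observed_swap_discrepancy:
  assumes top: "\<And>e. e \<in> F \<Longrightarrow> top_ranking m k C q e (\<rho> e)"
    and top': "\<And>e. e \<in> F \<Longrightarrow> top_ranking m k C q' e (\<rho> e)"
    and "z < m" "y < m" "observed_swap F \<rho> s z y"
  shows "(q y - q' y) - (q z - q' z) \<le> 2 * s"
proof -
  obtain a b where ab: "a \<in> F" "b \<in> F" "dist a b \<le> s"
      "reports_above (\<rho> a) z y" "reports_above (\<rho> b) y z"
    using assms(5) by (auto simp: observed_swap_def)
  have "q y - dist a (C ! y) \<le> q z - dist a (C ! z)"
    using reports_above_adjusted_quality[OF top] ab assms(4) by blast
  moreover have "q' z - dist b (C ! z) \<le> q' y - dist b (C ! y)"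
    using reports_above_adjusted_quality[OF top'] ab assms(3) by blast
  moreover have "dist a (C ! y) \<le> dist a b + dist b (C ! y)"
    "dist b (C ! z) \<le> dist a b + dist a (C ! z)"
    by (metis dist_triangle, metis dist_triangle dist_commute)
  ultimately show ?thesis using ab(3) by linarith
qed

text \<open>The bounds for single swaps telescope along a path from \<open>b\<close>. The vector
  \<open>q'\<close> is a reference consistent with the same reports.\<close>

lemma swap_ball_discrepancy:
  assumes top: "\<And>e. e \<in> F \<Longrightarrow> top_ranking m k C q e (\<rho> e)"
    and top': "\<And>e. e \<in> F \<Longrightarrow> top_ranking m k C q' e (\<rho> e)"
    and U: "U \<subseteq> {..<m}" "b \<in> U" and s: "s \<ge> 0"
    and c: "c \<in> swap_ball F \<rho> s U b n"
  shows "(q c - q' c) - (q b - q' b) \<le> 2 * s * real n"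
  using c
proof (induction n arbitrary: c)
  case 0
  then show ?case by simp
next
  case (Suc n)
  show ?case
  proof (cases "c \<in> swap_ball F \<rho> s U b n")
    case True
    then show ?thesis using Suc.IH[OF True] s by (simp add: algebra_simps)
  next
    case False
    then obtain z where z: "z \<in> swap_ball F \<rho> s U b n" "observed_swap F \<rho> s z c" "c \<in> U"
      using Suc.prems by auto
    then have "z < m" "c < m" using swap_ball_subset[OF U(2)] U(1) by blast+
    then show ?thesis
      using observed_swap_discrepancy[OF top top' _ _ z(2)] Suc.IH[OF z(1)]
      by (simp add: algebra_simps)
  qed
qed

text \<open>Take the topmost reported candidate outside the layer at each expert. It lies inside the
  ball at \<open>v\<close> and outside the larger ball at \<open>w\<close>, so along the chain from \<open>v\<close> to \<open>w\<close> it would have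
  to jump over the layer, and this jump is an observed swap.\<close>

lemma report_within_layer:
  assumes U: "b \<in> U" and s: "s \<ge> 0"
    and v: "v \<in> F" "\<And>y. y \<in> U \<Longrightarrow> reports_above (\<rho> v) b y"
    and w: "w \<in> F" "\<And>y. y \<in> U \<Longrightarrow> reports_above (\<rho> w) c y"
    and chain: "(v, w) \<in> (links F s)\<^sup>*"
    and c: "c \<in> U" "c \<notin> swap_ball F \<rho> s U b (Suc n)"
  shows "\<exists>e\<in>F. set (\<rho> e) \<inter> U \<subseteq> swap_ball F \<rho> s U b (Suc n) - swap_ball F \<rho> s U b n"
proof (rule ccontr)
  assume neg: "\<not> ?thesis"
  define P where "P = swap_ball F \<rho> s U b n"
  define W where "W = U - (swap_ball F \<rho> s U b (Suc n) - P)"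
  have PU: "P \<subseteq> U" unfolding P_def by (rule swap_ball_subset[OF U])
  have PW: "P \<subseteq> W" using PU unfolding W_def by auto
  have no_swap: False if "p \<in> P" "y \<in> W - P" "x \<in> F" "x' \<in> F" "dist x x' \<le> s"
    "reports_above (\<rho> x) p y" "reports_above (\<rho> x') y p" for p y x x'
  proof -
    have "observed_swap F \<rho> s p y" using that unfolding observed_swap_def by blast
    then have "y \<in> swap_ball F \<rho> s U b (Suc n)"
      using that(1,2) unfolding P_def W_def by auto
    then show False using that(2) unfolding W_def by auto
  qed
  have top: "\<exists>z\<in>W. \<forall>y\<in>W. reports_above (\<rho> e) z y" if "e \<in> F" for e
  proof -
    have "set (\<rho> e) \<inter> W \<noteq> {}"
      using neg that unfolding W_def P_def by blast
    then show ?thesis by (metis reports_above_topmost)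
  qed
  have "\<exists>z\<in>P. \<forall>y\<in>W. reports_above (\<rho> w) z y"
    using chain
  proof (induction rule: rtrancl_induct)
    case base
    then show ?case using v center_in_swap_ball unfolding P_def W_def by (metis DiffD1)
  next
    case (step x x')
    then obtain p where p: "p \<in> P" "\<forall>y\<in>W. reports_above (\<rho> x) p y" by auto
    obtain z where z: "z \<in> W" "\<forall>y\<in>W. reports_above (\<rho> x') z y" using top step(2) by (auto simp: links_def)
    have "z \<in> P"
      using no_swap[OF p(1), of z x x'] p z step(2) PW by (auto simp: links_def)
    then show ?case using z by auto
  qed
  then obtain p where p: "p \<in> P" "\<forall>y\<in>W. reports_above (\<rho> w) p y" by auto
  have "c \<in> W - P" using c unfolding W_def P_def by auto
  \<comment> \<open>Expert \<open>w\<close> plays both roles: its report puts \<open>c\<close> above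
    \<open>p\<close> by hypothesis and \<open>p\<close> above \<open>c\<close> by the induction, a
    swap at distance 0.\<close>
  then show False
    using no_swap[OF p(1), of c w w] p w s PU by auto
qed

text \<open>While \<open>c\<close> is not reached, every layer contains the remaining report of some
  expert, hence at least \<open>g\<close> candidates; \<open>n\<close> such layers and the center
  together exceed \<open>card U\<close>.\<close>

lemma top_in_swap_ball:
  assumes U: "finite U" "b \<in> U" and s: "s \<ge> 0"
    and v: "v \<in> F" "\<And>y. y \<in> U \<Longrightarrow> reports_above (\<rho> v) b y"
    and w: "w \<in> F" "\<And>y. y \<in> U \<Longrightarrow> reports_above (\<rho> w) c y"
    and chain: "(v, w) \<in> (links F s)\<^sup>*"
    and c: "c \<in> U"
    and g: "\<And>e. e \<in> F \<Longrightarrow> g \<le> card (set (\<rho> e) \<inter> U)"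
    and n: "card U \<le> n * g"
  shows "c \<in> swap_ball F \<rho> s U b n"
proof (rule ccontr)
  let ?B = "swap_ball F \<rho> s U b"
  have mono: "?B i \<subseteq> ?B j" if "i \<le> j" for i j
    using that by (induction rule: dec_induct) auto
  have fin: "finite (?B i)" for i
    using swap_ball_subset[OF U(2)] U(1) by (rule finite_subset)
  assume "c \<notin> ?B n"
  then have "i * g + 1 \<le> card (?B i)" if "i \<le> n" for i
    using that
  proof (induction i)
    case 0
    then show ?case by simp
  next
    case (Suc i)
    have "?B (Suc i) \<subseteq> ?B n"
      using Suc.prems by (intro mono)
    then have "c \<notin> ?B (Suc i)" using Suc.prems by blast
    from report_within_layer[OF U(2) s v w chain c this]
    obtain e where e: "e \<in> F" "set (\<rho> e) \<inter> U \<subseteq> ?B (Suc i) - ?B i" by auto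
    have "g \<le> card (?B (Suc i) - ?B i)"
      using g[OF e(1)] card_mono[OF _ e(2)] fin by (meson finite_Diff le_trans)
    moreover have "card (?B (Suc i)) = card (?B i) + card (?B (Suc i) - ?B i)"
      using card_Diff_subset[OF fin mono[of i "Suc i"]] card_mono[OF fin mono[of i "Suc i"]] by linarith
    ultimately show ?case using Suc.IH Suc.prems by (simp del: swap_ball.simps)
  qed
  from this[of n] have "card U < card (?B n)" using n by simp
  then show False using card_mono[OF U(1) swap_ball_subset[OF U(2)]] by (meson not_le)
qed

section \<open>Greedy choice of the winning set\<close>

text \<open>The pick is fixed before \<open>q\<close> is quantified: \<open>q'\<close> chooses it,
  and the swap ball limits how much \<open>q - q'\<close> can grow from the pick to any other
  expert's top candidate.\<close>

lemma greedy_pick: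
  assumes F: "finite F" "F \<noteq> {}"
    and cov: "\<And>j. j < m \<Longrightarrow> \<exists>x\<in>F. dist x (C ! j) \<le> \<eta>"
    and chain: "\<And>v w. v \<in> F \<Longrightarrow> w \<in> F \<Longrightarrow> (v, w) \<in> (links F s)\<^sup>*"
    and s: "s \<ge> 0"
    and S: "S \<subseteq> {..<m}" "card S < k"
    and n: "m \<le> n * (k - card S)"
    and q': "\<And>e. e \<in> F \<Longrightarrow> top_ranking m k C q' e (\<rho> e)"
  shows "\<exists>i\<in>{..<m} - S. \<forall>q. (\<forall>e\<in>F. top_ranking m k C q e (\<rho> e)) \<longrightarrow>
           (\<forall>j\<in>{..<m} - S. q j \<le> q i + (\<eta> + 2 * s * real n))"
proof -
  let ?U = "{..<m} - S"
  have g: "k - card S \<le> card (set (\<rho> e) \<inter> ?U)" if "e \<in> F" for e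
  proof -
    have "card (set (\<rho> e)) = k"
      using top_ranking_distinct[OF q'[OF that]] q'[OF that]
      by (simp add: distinct_card top_ranking_def)
    moreover have "set (\<rho> e) \<inter> ?U = set (\<rho> e) - S"
      using top_ranking_in_range[OF q'[OF that]] by auto
    ultimately show ?thesis
      using diff_card_le_card_Diff[of S "set (\<rho> e)"] S(1) finite_subset by auto
  qed
  have "\<exists>z. z \<in> ?U \<and> (\<forall>y\<in>?U. reports_above (\<rho> e) z y)" if "e \<in> F" for e
  proof -
    have "set (\<rho> e) \<inter> ?U \<noteq> {}" using g[OF that] S(2) by (metis card.empty le_zero_eq not_le zero_less_diff)
    then show ?thesis by (metis reports_above_topmost)
  qed
  then obtain \<tau> where \<tau>: "\<And>e. e \<in> F \<Longrightarrow> \<tau> e \<in> ?U"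
      "\<And>e y. e \<in> F \<Longrightarrow> y \<in> ?U \<Longrightarrow> reports_above (\<rho> e) (\<tau> e) y"
    by metis
  obtain v where v: "v \<in> F"
    and vmax: "\<And>w. w \<in> F \<Longrightarrow> q' (\<tau> w) - dist w (C ! \<tau> w) \<le> q' (\<tau> v) - dist v (C ! \<tau> v)"
    using arg_min_if_finite[OF F, of "\<lambda>w. - (q' (\<tau> w) - dist w (C ! \<tau> w))"]
    by (meson neg_less_iff_less not_less)
  have "q j \<le> q (\<tau> v) + (\<eta> + 2 * s * real n)"
    if q: "\<And>e. e \<in> F \<Longrightarrow> top_ranking m k C q e (\<rho> e)" and j: "j \<in> ?U" for q j
  proof -
    \<comment> \<open>\<open>\<tau> w\<close> beats \<open>j\<close> up to \<open>\<eta>\<close>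
      because \<open>w\<close> is close to \<open>j\<close>. In adjusted quality
      \<open>\<tau> v\<close> beats \<open>\<tau> w\<close> under \<open>q'\<close>, hence under
      \<open>q\<close> up to \<open>2 * s * n\<close>.\<close>
    obtain w where w: "w \<in> F" "dist w (C ! j) \<le> \<eta>" using cov j by auto
    have "q j - dist w (C ! j) \<le> q (\<tau> w) - dist w (C ! \<tau> w)"
      using reports_above_adjusted_quality[OF q[OF w(1)]] \<tau>(2)[OF w(1) j] j by auto
    moreover have "card ?U \<le> n * (k - card S)"
      using n card_mono[of "{..<m}" ?U] by auto
    then have "\<tau> w \<in> swap_ball F \<rho> s ?U (\<tau> v) n"
      using v w \<tau> s g chain
      by (intro top_in_swap_ball[where v = v and w = w and g = "k - card S"]) auto
    then have "(q (\<tau> w) - q' (\<tau> w)) - (q (\<tau> v) - q' (\<tau> v)) \<le> 2 * s * real n"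
      using swap_ball_discrepancy[OF q q' _ \<tau>(1)[OF v] s] by auto
    moreover note vmax[OF w(1)] w(2) zero_le_dist[of v "C ! \<tau> v"]
    ultimately show ?thesis by linarith
  qed
  then show ?thesis using \<tau>(1)[OF v] by blast
qed

text \<open>Exchange argument: a competing set of size \<open>h + 1\<close> has a member outside
  \<open>S\<close>, which is compared with the new pick; the others are compared with
  \<open>S\<close> by induction. After \<open>i\<close> picks, each report retains at least
  \<open>k - i\<close> candidates.\<close>

lemma greedy_committee:
  assumes F: "finite F" "F \<noteq> {}"
    and cov: "\<And>j. j < m \<Longrightarrow> \<exists>x\<in>F. dist x (C ! j) \<le> \<eta>"
    and chain: "\<And>v w. v \<in> F \<Longrightarrow> w \<in> F \<Longrightarrow> (v, w) \<in> (links F s)\<^sup>*"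
    and s: "s \<ge> 0"
    and q': "\<And>e. e \<in> F \<Longrightarrow> top_ranking m k C q' e (\<rho> e)"
    and "h \<le> k"
  shows "\<exists>S\<subseteq>{..<m}. card S = h \<and>
           (\<forall>q. (\<forall>e\<in>F. top_ranking m k C q e (\<rho> e)) \<longrightarrow>
             (\<forall>S'\<subseteq>{..<m}. card S' = h \<longrightarrow>
               sum q S' \<le> sum q S + (\<Sum>i<h. \<eta> + 2 * s * real (m div (k - i) + 1))))"
  using \<open>h \<le> k\<close>
proof (induction h)
  case 0
  show ?case
  proof (intro exI[of _ "{}"] conjI allI impI)
    fix q :: "nat \<Rightarrow> real" and S' :: "nat set"
    assume "S' \<subseteq> {..<m}" "card S' = 0"
    then have "S' = {}" by (metis card_0_eq finite_lessThan finite_subset)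
    then show "sum q S' \<le> sum q {} + (\<Sum>i<0. \<eta> + 2 * s * real (m div (k - i) + 1))" by simp
  qed auto
next
  case (Suc h)
  let ?err = "\<lambda>i. \<eta> + 2 * s * real (m div (k - i) + 1)"
  obtain S where S: "S \<subseteq> {..<m}" "card S = h"
    and Sq: "\<And>q S'. (\<And>e. e \<in> F \<Longrightarrow> top_ranking m k C q e (\<rho> e)) \<Longrightarrow> S' \<subseteq> {..<m} \<Longrightarrow> card S' = h
               \<Longrightarrow> sum q S' \<le> sum q S + (\<Sum>i<h. ?err i)"
    using Suc.IH Suc.prems by (metis Suc_leD)
  have fin: "finite T" if "T \<subseteq> {..<m}" for T :: "nat set"
    using that finite_subset by blast
  have lt: "card S < k" using S(2) Suc.prems by simp
  \<comment> \<open>The \<open>+ 1\<close> rounds the number of layers up, so that they exhaust all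
    \<open>m\<close> candidates.\<close>
  then have "m \<le> (m div (k - card S) + 1) * (k - card S)"
    using dividend_less_div_times[of "k - card S" m] by simp
  from greedy_pick[OF F cov chain s S(1) lt this q']
  obtain i where i: "i \<in> {..<m} - S"
    and iq: "\<forall>q. (\<forall>e\<in>F. top_ranking m k C q e (\<rho> e)) \<longrightarrow> (\<forall>j\<in>{..<m} - S. q j \<le> q i + ?err h)"
    unfolding S(2) by blast
  show ?case
  proof (intro exI[of _ "insert i S"] conjI allI impI)
    show "insert i S \<subseteq> {..<m}" "card (insert i S) = Suc h"
      using S i fin[OF S(1)] by auto
    fix q S'
    assume q: "\<forall>e\<in>F. top_ranking m k C q e (\<rho> e)" and S': "S' \<subseteq> {..<m}" "card S' = Suc h"
    have "\<not> S' \<subseteq> S"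
      using card_mono[OF fin[OF S(1)], of S'] S(2) S'(2) by auto
    then obtain j where j: "j \<in> S'" "j \<notin> S" by auto
    have "sum q (S' - {j}) \<le> sum q S + (\<Sum>i<h. ?err i)"
      using Sq[of q "S' - {j}"] q S' j fin[OF S'(1)] by auto
    moreover have "q j \<le> q i + ?err h"
      using iq q j S'(1) by blast
    moreover have "sum q S' = q j + sum q (S' - {j})"
      using j fin[OF S'(1)] by (simp add: sum.remove)
    moreover have "sum q (insert i S) = q i + sum q S"
      using i fin[OF S(1)] by simp
    ultimately show "sum q S' \<le> sum q (insert i S) + (\<Sum>i<Suc h. ?err i)"
      by simp
  qed
qed

text \<open>Any set that is safe for every quality vector consistent with the reports will do, so
  the rule only needs such a set to exist. The default \<open>{..<l}\<close> makes it a voting rule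
  on all inputs.\<close>

definition robust_rule ::
  "nat \<Rightarrow> nat \<Rightarrow> nat \<Rightarrow> real \<Rightarrow> 'a::metric_space list \<Rightarrow> 'a list \<Rightarrow> nat list list \<Rightarrow> nat set" where
  "robust_rule m k l \<epsilon> C E R =
     (let ok = (\<lambda>S. S \<subseteq> {..<m} \<and> card S = l \<and>
                 (\<forall>q. list_all2 (top_ranking m k C q) E R \<longrightarrow> cumulative_regret m l q S \<le> \<epsilon>))
      in if Ex ok then Eps ok else {..<l})"

lemma robust_rule_if_ex:
  assumes "S \<subseteq> {..<m}" "card S = l"
    and "\<And>q. list_all2 (top_ranking m k C q) E R \<Longrightarrow> cumulative_regret m l q S \<le> \<epsilon>"
  shows "robust_rule m k l \<epsilon> C E R \<subseteq> {..<m} \<and> card (robust_rule m k l \<epsilon> C E R) = l \<and>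
       (\<forall>q. list_all2 (top_ranking m k C q) E R \<longrightarrow>
          cumulative_regret m l q (robust_rule m k l \<epsilon> C E R) \<le> \<epsilon>)"
proof -
  define ok where "ok S \<longleftrightarrow> S \<subseteq> {..<m} \<and> card S = l \<and>
    (\<forall>q. list_all2 (top_ranking m k C q) E R \<longrightarrow> cumulative_regret m l q S \<le> \<epsilon>)" for S
  have "ok S" using assms unfolding ok_def by blast
  then have "ok (Eps ok)" "Ex ok" by (rule someI, rule exI)
  then have "ok (robust_rule m k l \<epsilon> C E R)"
    unfolding robust_rule_def Let_def ok_def[symmetric] by simp
  then show ?thesis unfolding ok_def .
qed

lemma robust_rule_voting_rule:
  assumes "l \<le> m"
  shows "robust_rule m k l \<epsilon> \<in> voting_rules \<Theta> m k l"
proof -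
  have "robust_rule m k l \<epsilon> C E R \<subseteq> {..<m} \<and> card (robust_rule m k l \<epsilon> C E R) = l" for C E R
  proof (cases "\<exists>S\<subseteq>{..<m}. card S = l \<and>
      (\<forall>q. list_all2 (top_ranking m k C q) E R \<longrightarrow> cumulative_regret m l q S \<le> \<epsilon>)")
    case True
    then show ?thesis using robust_rule_if_ex by blast
  next
    case False
    then have "robust_rule m k l \<epsilon> C E R = {..<l}"
      unfolding robust_rule_def Let_def by (subst if_not_P) auto
    then show ?thesis using assms by auto
  qed
  then show ?thesis unfolding voting_rules_def by blast
qed

lemma robust_rule_guarantees_regret:
  fixes E :: "'a::metric_space list"
  assumes E: "E \<noteq> []"
    and cov: "\<And>z. z \<in> \<Theta> \<Longrightarrow> \<exists>x\<in>set E. dist x z \<le> \<eta>"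
    and chain: "\<And>v w. v \<in> set E \<Longrightarrow> w \<in> set E \<Longrightarrow> (v, w) \<in> (links (set E) s)\<^sup>*"
    and s: "s \<ge> 0" and "l \<le> k" "l \<le> m"
    and err: "(\<Sum>i<l. \<eta> + 2 * s * real (m div (k - i) + 1)) \<le> \<epsilon>"
  shows "guarantees_regret \<Theta> m k l (robust_rule m k l \<epsilon>) \<epsilon> E"
  unfolding guarantees_regret_def
proof (intro allI impI, elim conjE)
  fix C :: "'a list" and q' and R
  assume C: "length C = m" "set C \<subseteq> \<Theta>" and R: "list_all2 (top_ranking m k C q') E R"
  \<comment> \<open>A location may occur several times in \<open>E\<close> with different reports;
    \<open>idx\<close> selects one occurrence, so that \<open>\<rho>\<close> is a function of the
    location.\<close>
  have "\<exists>v<length E. E ! v = e" if "e \<in> set E" for e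
    using that by (simp add: in_set_conv_nth)
  then obtain idx where idx: "\<And>e. e \<in> set E \<Longrightarrow> idx e < length E \<and> E ! idx e = e"
    by metis
  define \<rho> where "\<rho> e = R ! idx e" for e
  have \<rho>: "top_ranking m k C q e (\<rho> e)" if "e \<in> set E" "list_all2 (top_ranking m k C q) E R" for q e
    using idx[OF that(1)] list_all2_nthD[OF that(2)] unfolding \<rho>_def by metis
  have cov': "\<exists>x\<in>set E. dist x (C ! j) \<le> \<eta>" if "j < m" for j
    using cov C that nth_mem by blast
  \<comment> \<open>The true quality may serve as the reference, since the resulting
    \<open>S\<close> is safe for all consistent qualities and only its existence matters.\<close>
  obtain S where S: "S \<subseteq> {..<m}" "card S = l"
    and Sq: "\<And>q S'. (\<forall>e\<in>set E. top_ranking m k C q e (\<rho> e)) \<Longrightarrow> S' \<subseteq> {..<m} \<Longrightarrow> card S' = l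
               \<Longrightarrow> sum q S' \<le> sum q S + (\<Sum>i<l. \<eta> + 2 * s * real (m div (k - i) + 1))"
    using greedy_committee[of "set E" m C \<eta> s k q' \<rho> l] E cov' chain s \<rho> R \<open>l \<le> k\<close> by auto
  have "cumulative_regret m l q S \<le> \<epsilon>" if "list_all2 (top_ranking m k C q) E R" for q
  proof (rule cumulative_regret_le[OF \<open>l \<le> m\<close>])
    fix S' assume "S' \<subseteq> {..<m}" "card S' = l"
    then show "sum q S' \<le> sum q S + \<epsilon>" using Sq[of q S'] \<rho> that err by force
  qed
  then show "cumulative_regret m l q' (robust_rule m k l \<epsilon> C E R) \<le> \<epsilon>"
    using robust_rule_if_ex[OF S, of k C E R \<epsilon>] R by blast
qed

section \<open>Linked committees from covers\<close>

text \<open>Connectedness: the closed balls around \<open>Y\<close> and around \<open>X - Y\<close>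
  together cover \<open>\<Theta>\<close>, so two of them share a point.\<close>

lemma nearby_cover_points:
  fixes \<Theta> :: "'a::real_normed_vector set"
  assumes "convex \<Theta>" "finite X" "is_cover \<Theta> \<eta> X" "Y \<subseteq> X" "Y \<noteq> {}" "Y \<noteq> X" "\<eta> \<ge> 0"
  shows "\<exists>y\<in>Y. \<exists>x\<in>X - Y. dist y x \<le> 2 * \<eta>"
proof -
  define A where "A = (\<Union>y\<in>Y. cball y \<eta>)"
  define B where "B = (\<Union>x\<in>X - Y. cball x \<eta>)"
  have "closed A" "closed B"
    unfolding A_def B_def using assms finite_subset by (auto intro!: closed_UN)
  moreover have "\<Theta> \<subseteq> A \<union> B"
    using assms(3) unfolding A_def B_def is_cover_def by (auto simp: dist_commute) blast
  moreover have "A \<inter> \<Theta> \<noteq> {}" "B \<inter> \<Theta> \<noteq> {}"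
  proof -
    obtain y x where "y \<in> Y" "x \<in> X - Y" using assms by auto
    then have "y \<in> A \<inter> \<Theta>" "x \<in> B \<inter> \<Theta>"
      using assms unfolding A_def B_def is_cover_def by force+
    then show "A \<inter> \<Theta> \<noteq> {}" "B \<inter> \<Theta> \<noteq> {}" by blast+
  qed
  ultimately have "A \<inter> B \<inter> \<Theta> \<noteq> {}"
    using convex_connected[OF assms(1)] unfolding connected_closed by blast
  then obtain z where "z \<in> A" "z \<in> B" by blast
  then obtain y x where "y \<in> Y" "x \<in> X - Y" "dist y z \<le> \<eta>" "dist x z \<le> \<eta>"
    unfolding A_def B_def UN_iff mem_cball by metis
  moreover have "dist y x \<le> dist y z + dist x z" by (metis dist_triangle2)
  ultimately show ?thesis by force
qed

lemma links_rtrancl_mono: "F \<subseteq> G \<Longrightarrow> (links F s)\<^sup>* \<subseteq> (links G s)\<^sup>*"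
  by (rule rtrancl_mono) (auto simp: links_def)

lemma sym_links_rtrancl: "sym ((links F s)\<^sup>*)"
  by (rule sym_rtrancl) (auto simp: sym_def links_def dist_commute)

text \<open>Growing the set of visited cover points one at a time amounts to subdividing the edges of a
  spanning tree of the cover, each of length at most \<open>2 * \<eta>\<close>, into \<open>c\<close> parts.\<close>

lemma linked_refinement:
  fixes \<Theta> :: "'a::real_normed_vector set"
  assumes conv: "convex \<Theta>" and X: "finite X" "is_cover \<Theta> \<eta> X" "X \<noteq> {}"
    and \<eta>: "\<eta> \<ge> 0" and c: "c > 0"
  shows "\<exists>F. finite F \<and> X \<subseteq> F \<and> F \<subseteq> \<Theta> \<and> card F \<le> 1 + (card X - 1) * c \<and>
           (\<forall>v\<in>F. \<forall>w\<in>F. (v, w) \<in> (links F (2 * \<eta> / real c))\<^sup>*)"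
proof -
  let ?s = "2 * \<eta> / real c"
  have X\<Theta>: "X \<subseteq> \<Theta>" using X by (simp add: is_cover_def)
  have "\<exists>Y F. Y \<subseteq> X \<and> card Y = j \<and> finite F \<and> Y \<subseteq> F \<and> F \<subseteq> \<Theta> \<and> card F \<le> 1 + (j - 1) * c \<and>
           (\<forall>v\<in>F. \<forall>w\<in>F. (v, w) \<in> (links F ?s)\<^sup>*)" if "1 \<le> j" "j \<le> card X" for j
    using that
  proof (induction j rule: nat_induct_at_least)
    case base
    obtain x where "x \<in> X" using X by auto
    then show ?case using X\<Theta> by (intro exI[of _ "{x}"]) auto
  next
    case (Suc j)
    then obtain Y F where Y: "Y \<subseteq> X" "card Y = j"
      and F: "finite F" "Y \<subseteq> F" "F \<subseteq> \<Theta>" "card F \<le> 1 + (j - 1) * c"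
        "\<forall>v\<in>F. \<forall>w\<in>F. (v, w) \<in> (links F ?s)\<^sup>*"
      by auto
    have "Y \<noteq> {}" "Y \<noteq> X" using Y Suc by auto
    then obtain y x where yx: "y \<in> Y" "x \<in> X - Y" "dist y x \<le> 2 * \<eta>"
      using nearby_cover_points[OF conv X(1,2) Y(1)] \<eta> by blast
    define p where "p i = y + (real i / real c) *\<^sub>R (x - y)" for i
    \<comment> \<open>The point \<open>p 0 = y\<close> is already in \<open>F\<close>, so each edge
      of the tree adds at most \<open>c\<close> points.\<close>
    define G where "G = F \<union> p ` {1..c}"
    have p_in: "p i \<in> \<Theta>" if "i \<le> c" for i
    proof -
      have "p i = (1 - real i / real c) *\<^sub>R y + (real i / real c) *\<^sub>R x"
        unfolding p_def by (simp add: algebra_simps)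
      then show ?thesis
        using convexD_alt[OF conv, of y x "real i / real c"] that c yx Y X\<Theta> by auto
    qed
    have p0: "p 0 = y" and pc: "p c = x" using c unfolding p_def by auto
    have p_in_G: "p i \<in> G" if "i \<le> c" for i
      using that yx F p0 unfolding G_def by (cases "i = 0") auto
    have step: "dist (p (Suc i)) (p i) \<le> ?s" for i
    proof -
      have "p (Suc i) - p i = (1 / real c) *\<^sub>R (x - y)"
        unfolding p_def by (simp add: algebra_simps add_divide_distrib)
      then have "dist (p (Suc i)) (p i) = dist y x / real c"
        by (simp add: dist_norm norm_minus_commute)
      then show ?thesis using yx c by (simp add: divide_right_mono)
    qed
    have "(p i, y) \<in> (links G ?s)\<^sup>*" if "i \<le> c" for i
      using that
    proof (induction i)
      case 0
      then show ?case using p0 by simp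
    next
      case (Suc i)
      have "(p (Suc i), p i) \<in> links G ?s"
        using p_in_G Suc.prems step by (auto simp: links_def)
      then show ?case using Suc by (meson Suc_leD converse_rtrancl_into_rtrancl)
    qed
    moreover have "(v, y) \<in> (links G ?s)\<^sup>*" if "v \<in> F" for v
      using F that yx links_rtrancl_mono[of F G ?s] unfolding G_def by blast
    ultimately have to_y: "(v, y) \<in> (links G ?s)\<^sup>*" if "v \<in> G" for v
      using that unfolding G_def by auto
    then have conn: "\<forall>v\<in>G. \<forall>w\<in>G. (v, w) \<in> (links G ?s)\<^sup>*"
      by (meson rtrancl_trans symD sym_links_rtrancl)
    have "card G \<le> card F + card (p ` {1..c})" unfolding G_def by (rule card_Un_le)
    also have "card (p ` {1..c}) \<le> c" using card_image_le[of "{1..c}" p] by simp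
    finally have "card G \<le> 1 + (j - 1) * c + c" using F(4) by simp
    also have "\<dots> = 1 + (Suc j - 1) * c" using Suc(1) by (cases j) auto
    finally have "card G \<le> 1 + (Suc j - 1) * c" .
    moreover have "card (insert x Y) = Suc j" using yx Y finite_subset[OF Y(1) X(1)] by auto
    moreover have "insert x Y \<subseteq> G" using F pc c unfolding G_def by auto
    moreover have "finite G" "G \<subseteq> \<Theta>" using F p_in unfolding G_def by auto
    moreover have "insert x Y \<subseteq> X" using yx Y by auto
    ultimately show ?case using conn by blast
  qed
  from this[of "card X"] X obtain Y F where Y: "Y \<subseteq> X" "card Y = card X"
      and F: "finite F" "Y \<subseteq> F" "F \<subseteq> \<Theta>" "card F \<le> 1 + (card X - 1) * c"
        "\<forall>v\<in>F. \<forall>w\<in>F. (v, w) \<in> (links F ?s)\<^sup>*"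
    by (metis One_nat_def Suc_leI card_gt_0_iff order_refl)
  then have "Y = X" using card_subset_eq[OF X(1)] by blast
  then show ?thesis using F by blast
qed

section \<open>Harmonic sums and the size of the committee\<close>

text \<open>Telescoping of \<open>1 / g \<le> ln g - ln (g - 1)\<close>, which is
  \<open>ln x \<le> x - 1\<close> at \<open>x = (g - 1) / g\<close>.\<close>

lemma sum_reciprocals_le_ln:
  assumes "l < k"
  shows "(\<Sum>i<l. 1 / real (k - i)) \<le> ln (real k / (real k - real l))"
  using assms
proof (induction l)
  case 0
  then show ?case by simp
next
  case (Suc l)
  define g where "g = real k - real l"
  have g: "g > 1" using Suc.prems by (simp add: g_def)
  have "ln ((g - 1) / g) \<le> (g - 1) / g - 1"
    using g by (intro ln_le_minus_one) simp
  moreover have "ln ((g - 1) / g) = ln (g - 1) - ln g" "(g - 1) / g - 1 = - (1 / g)"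
    using g by (simp_all add: ln_div field_simps)
  ultimately have "1 / g \<le> ln g - ln (g - 1)" by linarith
  moreover have "ln (real k / g) = ln (real k) - ln g"
    "ln (real k / (g - 1)) = ln (real k) - ln (g - 1)"
    using g Suc.prems by (simp_all add: ln_div)
  moreover have g_eq: "real (k - l) = g" "real k - real (Suc l) = g - 1"
    using Suc.prems by (simp_all add: g_def of_nat_diff)
  moreover have "(\<Sum>i<l. 1 / real (k - i)) \<le> ln (real k / g)"
    using Suc.IH Suc.prems unfolding g_def by (meson Suc_lessD)
  ultimately show ?case unfolding sum.lessThan_Suc g_eq by linarith
qed

lemma sum_reciprocals_le_ln_self:
  assumes "k > 0"
  shows "(\<Sum>i<k. 1 / real (k - i)) \<le> 1 + ln (real k)"
proof -
  obtain n where n: "k = Suc n" using assms gr0_conv_Suc by blast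
  then have "(\<Sum>i<k. 1 / real (k - i)) = (\<Sum>i<n. 1 / real (k - i)) + 1" by simp
  then show ?thesis using sum_reciprocals_le_ln[of n k] n by simp
qed

text \<open>Error budget: \<open>l * \<eta> = \<epsilon> / 2\<close> for the covering radius, and
  \<open>3/8 * \<epsilon> * A / c\<close> for the layers. As \<open>A / c \<le> 16/15\<close>, the
  total is at most \<open>9/10 * \<epsilon>\<close>.\<close>

lemma committee_from_cover:
  fixes \<Theta> :: "'a::real_normed_vector set"
  assumes conv: "convex \<Theta>" and \<epsilon>: "\<epsilon> > 0" and l: "1 \<le> l" "l \<le> k" and m: "2 * k \<le> m"
    and X: "finite X" "is_cover \<Theta> (\<epsilon> / (2 * real l)) X" "2 \<le> card X"
    and H: "(\<Sum>i<l. 1 / real (k - i)) \<le> H"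
  shows "\<exists>f\<in>voting_rules \<Theta> m k l. \<exists>E. set E \<subseteq> \<Theta> \<and> guarantees_regret \<Theta> m k l f \<epsilon> E \<and>
           real (length E) \<le> (8 * real m / real l * H + 1) * (real (card X) - 1)"
proof -
  define \<eta> where "\<eta> = \<epsilon> / (2 * real l)"
  define A where "A = 8 * real m / real l * H"
  define c where "c = nat \<lfloor>A\<rfloor>"
  define s where "s = 2 * \<eta> / real c"
  have pos: "real l > 0" "real k > 0" "\<eta> > 0" using l \<epsilon> by (auto simp: \<eta>_def)
  \<comment> \<open>Every summand is at least \<open>1 / k\<close>. This gives
    \<open>A \<ge> 8 * m / k \<ge> 16\<close>, so rounding \<open>A\<close> down loses at most a
    sixteenth of it.\<close>
  have "real l / real k = (\<Sum>i<l. 1 / real k)" by simp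
  also have "\<dots> \<le> (\<Sum>i<l. 1 / real (k - i))"
    using l by (intro sum_mono frac_le) auto
  finally have "real l / real k \<le> H" using H by simp
  then have "8 * real m / real l * (real l / real k) \<le> A"
    unfolding A_def by (intro mult_left_mono) auto
  moreover have "16 \<le> 8 * real m / real l * (real l / real k)"
    using m pos by (simp add: field_simps)
  ultimately have A: "A \<ge> 16" by simp
  then have c: "real c \<le> A" "real c \<ge> 15 / 16 * A" "c > 0"
    unfolding c_def by linarith+
  have s: "s > 0" using pos c unfolding s_def by simp
  obtain F where F: "finite F" "X \<subseteq> F" "F \<subseteq> \<Theta>" "card F \<le> 1 + (card X - 1) * c"
      and conn: "\<forall>v\<in>F. \<forall>w\<in>F. (v, w) \<in> (links F s)\<^sup>*"
    using linked_refinement[OF conv X(1), of \<eta> c] X c pos unfolding \<eta>_def s_def by force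
  obtain E where E: "set E = F" "distinct E" using F(1) finite_distinct_list by blast
  have "(\<Sum>i<l. \<eta> + 2 * s * real (m div (k - i) + 1)) \<le> (\<Sum>i<l. \<eta> + 3 * s * real m * (1 / real (k - i)))"
  proof (rule sum_mono)
    fix i assume "i \<in> {..<l}"
    then have g: "0 < k - i" "k - i \<le> k" using l by auto
    have "real (m div (k - i)) \<le> real m / real (k - i)" by (rule of_nat_div_le_of_nat)
    \<comment> \<open>As \<open>m / (k - i) \<ge> 2\<close>, the rounding term 1 costs only a factor
      \<open>3/2\<close>.\<close>
    moreover have "2 * (k - i) \<le> m" using g m by simp
    then have "1 \<le> real m / real (k - i) / 2" using g by (simp add: field_simps)
    ultimately have "real (m div (k - i) + 1) \<le> 3 / 2 * (real m / real (k - i))" by simp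
    then have "2 * s * real (m div (k - i) + 1) \<le> 2 * s * (3 / 2 * (real m / real (k - i)))"
      using s by (intro mult_left_mono) auto
    then show "\<eta> + 2 * s * real (m div (k - i) + 1) \<le> \<eta> + 3 * s * real m * (1 / real (k - i))"
      by simp
  qed
  also have "\<dots> = real l * \<eta> + 3 * s * real m * (\<Sum>i<l. 1 / real (k - i))"
    by (simp add: sum.distrib sum_distrib_left)
  also have "\<dots> \<le> real l * \<eta> + 3 * s * real m * H"
    using H s by (intro add_left_mono mult_left_mono) auto
  also have "real l * \<eta> = \<epsilon> / 2" using pos by (simp add: \<eta>_def)
  also have "3 * s * real m * H = 3 / 8 * \<epsilon> * (A / real c)"
    using pos c by (simp add: s_def \<eta>_def A_def field_simps)
  also have "A / real c \<le> 16 / 15" using c A by (simp add: field_simps)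
  finally have "(\<Sum>i<l. \<eta> + 2 * s * real (m div (k - i) + 1)) \<le> \<epsilon> / 2 + 3 / 8 * \<epsilon> * (16 / 15)"
    using \<epsilon> by simp
  then have err: "(\<Sum>i<l. \<eta> + 2 * s * real (m div (k - i) + 1)) \<le> \<epsilon>" using \<epsilon> by linarith
  have "E \<noteq> []" using E F X by auto
  moreover have "\<exists>x\<in>set E. dist x z \<le> \<eta>" if "z \<in> \<Theta>" for z
    using X(2) F(2) E that unfolding is_cover_def \<eta>_def by (metis dist_commute subsetD)
  ultimately have "guarantees_regret \<Theta> m k l (robust_rule m k l \<epsilon>) \<epsilon> E"
    using conn E s l m err by (intro robust_rule_guarantees_regret) auto
  moreover have "real (length E) \<le> (A + 1) * (real (card X) - 1)"
  proof -
    define d where "d = card X - 1"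
    have dX: "real d = real (card X) - 1" using X(3) by (simp add: d_def of_nat_diff)
    have d: "card F \<le> 1 + d * c" "1 \<le> d" using F(4) X(3) by (simp_all add: d_def)
    have "length E = card F" using E distinct_card by fastforce
    \<comment> \<open>The root of the tree is paid for by \<open>d \<ge> 1\<close>.\<close>
    also have "\<dots> \<le> (c + 1) * d" using d by (simp add: algebra_simps)
    finally have "real (length E) \<le> real ((c + 1) * d)" by (rule of_nat_mono)
    also have "\<dots> = (real c + 1) * (real (card X) - 1)"
      unfolding dX[symmetric] by (simp add: algebra_simps)
    also have "\<dots> \<le> (A + 1) * (real (card X) - 1)"
      using c X(3) by (intro mult_right_mono) auto
    finally show ?thesis .
  qed
  ultimately show ?thesis
    using robust_rule_voting_rule[of l m k \<epsilon> \<Theta>] E F l m unfolding A_def by auto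
qed

section \<open>Lower bound\<close>

text \<open>The \<open>k\<close> candidates at a best location \<open>w\<close> tie at the top, so
  listing their block in index order is a legal report; it depends on \<open>Q\<close> only through
  \<open>w\<close>.\<close>

lemma block_top_ranking:
  assumes "i * k + k \<le> m"
    and "\<And>h. h < k \<Longrightarrow> C ! (i * k + h) = w"
    and "\<And>j. j < m \<Longrightarrow> Q (C ! j) - dist e (C ! j) \<le> Q w - dist e w"
  shows "top_ranking m k C (\<lambda>j. Q (C ! j)) e [i * k..<i * k + k]"
  unfolding top_ranking_def is_arg_max_def
proof (intro conjI allI impI)
  fix h assume h: "h < k"
  then have nth: "[i * k..<i * k + k] ! h = i * k + h" by simp
  show "[i * k..<i * k + k] ! h \<in> {..<m} - set (take h [i * k..<i * k + k])"
    using h assms(1) unfolding nth by (auto simp: take_upt)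
  show "\<nexists>y. y \<in> {..<m} - set (take h [i * k..<i * k + k]) \<and>
     Q (C ! ([i * k..<i * k + k] ! h)) - dist e (C ! ([i * k..<i * k + k] ! h)) < Q (C ! y) - dist e (C ! y)"
    using assms(2)[OF h] assms(3) unfolding nth by (auto simp: not_less)
qed simp

lemma block_of_candidates:
  fixes L :: "'a set"
  assumes "finite L" "card L * k \<le> m" "p \<in> L" "0 < k"
  obtains C :: "'a list" and block where "length C = m" "set C \<subseteq> L"
    and "\<And>w. w \<in> L \<Longrightarrow> block w * k + k \<le> m"
    and "\<And>w h. w \<in> L \<Longrightarrow> h < k \<Longrightarrow> C ! (block w * k + h) = w"
proof -
  obtain W where W: "set W = L" "distinct W" using assms(1) finite_distinct_list by blast
  then have len: "length W = card L" using distinct_card by fastforce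
  \<comment> \<open>Surplus candidates go to \<open>p\<close>, so no location outside
    \<open>L\<close> arises.\<close>
  define C where "C = map (\<lambda>j. if j div k < length W then W ! (j div k) else p) [0..<m]"
  have "\<exists>i<length W. W ! i = w" if "w \<in> L" for w
    using that W by (auto simp: in_set_conv_nth)
  then obtain block where block: "\<And>w. w \<in> L \<Longrightarrow> block w < length W \<and> W ! block w = w" by metis
  have bound: "block w * k + k \<le> m" if "w \<in> L" for w
  proof -
    have "(block w + 1) * k \<le> card L * k"
      using block[OF that] len by (intro mult_right_mono) auto
    then show ?thesis using assms(2) by simp
  qed
  have "C ! (block w * k + h) = w" if "w \<in> L" "h < k" for w h
  proof -
    have "(block w * k + h) div k = block w" using that assms(4) by simp
    moreover have "block w * k + h < m" using bound[OF that(1)] that(2) by simp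
    ultimately show ?thesis using block[OF that(1)] by (simp add: C_def)
  qed
  moreover have "length C = m" "set C \<subseteq> L"
    using assms(3) W(1) nth_mem unfolding C_def by fastforce+
  ultimately show ?thesis using that bound by blast
qed

text \<open>An expert reports candidates at her own location, unless some decoy in \<open>X\<close> is closer to her
  than \<open>p\<close> by \<open>6 * \<delta>\<close>; then she reports a nearest decoy. These reports are consistent with the quality
  \<open>Q2\<close>, which is low around \<open>p\<close> and \<open>0\<close> on \<open>X\<close>, and with \<open>Q1\<close>, which adds a cone with peak \<open>6 * \<delta>\<close>
  at \<open>p\<close>. A winning set that is mostly near \<open>p\<close> is bad for \<open>Q2\<close>, any other one is bad for \<open>Q1\<close>.\<close>

lemma adversary:
  fixes \<Theta> :: "'a::metric_space set"
  assumes \<delta>: "\<delta> > 0" and l: "1 \<le> l" "l \<le> k"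
    and p: "p \<in> \<Theta>" and X: "finite X" "X \<noteq> {}" "X \<subseteq> \<Theta>"
    and X_away: "\<And>x. x \<in> X \<Longrightarrow> dist x p \<ge> 11 / 2 * \<delta>"
    and X_far: "\<And>e. e \<in> \<Theta> \<Longrightarrow> dist e p \<ge> 12 * \<delta> \<Longrightarrow> \<exists>x\<in>X. dist e x \<le> dist e p - 6 * \<delta>"
    and f: "f \<in> voting_rules \<Theta> m k l" and E: "set E \<subseteq> \<Theta>"
    and m: "(card (set E \<inter> ball p (12 * \<delta>)) + card X + 1) * k \<le> m"
  shows "\<not> guarantees_regret \<Theta> m k l f (real l * \<delta>) E"
proof
  assume guar: "guarantees_regret \<Theta> m k l f (real l * \<delta>) E"
  define far where "far e \<longleftrightarrow> (\<exists>x\<in>X. dist e x \<le> dist e p - 6 * \<delta>)" for e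
  define loc where "loc e = (if far e then arg_min_on (dist e) X else e)" for e
  define L where "L = insert p ((set E \<inter> {e. \<not> far e}) \<union> X)"
  \<comment> \<open>Experts outside the ball are far by \<open>X_far\<close>, so only those inside
    it add their own locations to \<open>L\<close>.\<close>
  have near: "set E \<inter> {e. \<not> far e} \<subseteq> set E \<inter> ball p (12 * \<delta>)"
    using X_far E unfolding far_def by (force simp: dist_commute not_le)
  have "card L \<le> 1 + card ((set E \<inter> {e. \<not> far e}) \<union> X)"
    using X(1) unfolding L_def by (simp add: card_insert_if)
  also have "\<dots> \<le> 1 + (card (set E \<inter> {e. \<not> far e}) + card X)"
    by (intro add_left_mono card_Un_le)
  also have "\<dots> \<le> card (set E \<inter> ball p (12 * \<delta>)) + card X + 1"
    using card_mono[OF _ near] by simp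
  finally have "card L * k \<le> m" using m by (meson le_trans mult_le_mono1)
  then obtain C block where C: "length C = m" "set C \<subseteq> L"
      and block: "\<And>w. w \<in> L \<Longrightarrow> block w * k + k \<le> m"
      and C_block: "\<And>w h. w \<in> L \<Longrightarrow> h < k \<Longrightarrow> C ! (block w * k + h) = w"
    using block_of_candidates[of L k m p] X l unfolding L_def by auto
  have L\<Theta>: "L \<subseteq> \<Theta>" using p X E unfolding L_def by auto
  have argmin: "arg_min_on (dist e) X \<in> X" "\<And>x. x \<in> X \<Longrightarrow> dist e (arg_min_on (dist e) X) \<le> dist e x" for e
    using arg_min_if_finite[OF X(1,2), of "dist e"] by (auto simp: not_less)
  have loc_L: "loc e \<in> L" if "e \<in> set E" for e
    using that argmin(1) unfolding loc_def L_def by auto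
  define R where "R = map (\<lambda>e. [block (loc e) * k..<block (loc e) * k + k]) E"
  define Q2 where "Q2 u = - infdist u X" for u
  define Q1 where "Q1 u = max (6 * \<delta> - dist u p) (Q2 u)" for u
  \<comment> \<open>Both qualities are 1-Lipschitz, which makes an expert's own location optimal for
    that expert.\<close>
  have Q2_lip: "Q2 u - Q2 w \<le> dist u w" for u w
    using infdist_triangle[of w X u] unfolding Q2_def by (simp add: dist_commute)
  have Q1_lip: "Q1 u - Q1 w \<le> dist u w" for u w
    using Q2_lip[of u w] dist_triangle[of w p u] unfolding Q1_def by (simp add: dist_commute)
  have Q2_X: "Q2 x = 0" if "x \<in> X" for x using that unfolding Q2_def by simp
  have Q2_nonpos: "Q2 u \<le> 0" for u unfolding Q2_def by (simp add: infdist_nonneg)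
  have inf_argmin: "infdist e X = dist e (arg_min_on (dist e) X)" for e
    using argmin X(2) infdist_le[of "arg_min_on (dist e) X" X e]
    by (intro antisym) (auto simp: infdist_notempty intro: cINF_greatest)
  have pref2: "Q2 u - dist e u \<le> Q2 (loc e) - dist e (loc e)" for e u
  proof (cases "far e")
    case True
    have "infdist e X \<le> infdist u X + dist e u" by (rule infdist_triangle)
    then show ?thesis
      using True argmin(1)[of e] Q2_X inf_argmin[of e] unfolding loc_def Q2_def by auto
  next
    case False
    then show ?thesis using Q2_lip[of u e] by (simp add: loc_def dist_commute)
  qed
  have pref1: "Q1 u - dist e u \<le> Q1 (loc e) - dist e (loc e)" for e u
  proof (cases "far e")
    case True
    then obtain x where x: "x \<in> X" "dist e x \<le> dist e p - 6 * \<delta>" unfolding far_def by auto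
    have "dist e (loc e) \<le> dist e x" "Q2 (loc e) = 0"
      using True x argmin Q2_X by (auto simp: loc_def)
    \<comment> \<open>The cone yields adjusted quality at most
      \<open>6 * \<delta> - dist e p\<close>, and the nearest decoy attains at least that.\<close>
    moreover have "dist e p \<le> dist e u + dist u p" by (rule dist_triangle)
    ultimately show ?thesis using x pref2[of u e] unfolding Q1_def by linarith
  next
    case False
    then show ?thesis using Q1_lip[of u e] by (simp add: loc_def dist_commute)
  qed
  have consistent: "list_all2 (top_ranking m k C (\<lambda>j. Q (C ! j))) E R"
    if "\<And>e u. Q u - dist e u \<le> Q (loc e) - dist e (loc e)" for Q
    unfolding R_def list_all2_map2
    using that loc_L block C_block
    by (intro list.rel_refl_strong block_top_ranking[where w = "loc _"]) auto
  define S where "S = f C E R"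
  have "length r = k \<and> distinct r \<and> set r \<subseteq> {..<m}" if "r \<in> set R" for r
    using that block loc_L unfolding R_def by fastforce
  then have S: "S \<subseteq> {..<m}" "card S = l"
    using f C L\<Theta> E unfolding S_def voting_rules_def by (auto simp: R_def)
  then have finS: "finite S" using finite_subset by auto
  have regret: "real l * Q w - (\<Sum>j\<in>S. Q (C ! j)) \<le> real l * \<delta>"
    if w: "w \<in> L" and Q: "\<And>e u. Q u - dist e u \<le> Q (loc e) - dist e (loc e)" for Q w
  proof -
    let ?S' = "{block w * k..<block w * k + l}"
    have "?S' \<subseteq> {..<m}" "card ?S' = l" using block[OF w] l by auto
    then have "(\<Sum>j\<in>?S'. Q (C ! j)) - (\<Sum>j\<in>S. Q (C ! j)) \<le> real l * \<delta>"
      using sum_le_cumulative_regret[of ?S' m l "\<lambda>j. Q (C ! j)" S]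
        guar consistent[OF Q] C L\<Theta> unfolding guarantees_regret_def S_def by fastforce
    moreover have "(\<Sum>j\<in>?S'. Q (C ! j)) = (\<Sum>j\<in>?S'. Q w)"
    proof (rule sum.cong)
      fix j assume "j \<in> ?S'"
      then show "Q (C ! j) = Q w"
        using C_block[OF w, of "j - block w * k"] l by auto
    qed simp
    ultimately show ?thesis by simp
  qed
  \<comment> \<open>Outside radius \<open>3 * \<delta>\<close>, \<open>Q1\<close> is at most half of
    its peak. Inside it, decoys are at least \<open>(11/2 - 3) * \<delta>\<close> away, so
    \<open>Q2 \<le> - (5/2 * \<delta>)\<close>.\<close>
  define S0 where "S0 = {j \<in> S. dist (C ! j) p < 3 * \<delta>}"
  have S0: "S0 \<subseteq> S" "card S0 \<le> l"
    using card_mono[OF finS, of S0] S unfolding S0_def by auto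
  have card_rest: "real (card (S - S0)) = real l - real (card S0)"
    using S S0 card_Diff_subset[OF finite_subset[OF S0(1) finS] S0(1)] by (simp add: of_nat_diff)
  have split: "sum h S = sum h S0 + sum h (S - S0)" for h :: "nat \<Rightarrow> real"
    using sum.subset_diff[OF S0(1) finS] by (simp add: add.commute)
  show False
  proof (cases "2 * card S0 \<le> l")
    case True
    \<comment> \<open>At most half of the picks can reach \<open>6 * \<delta>\<close>, so the sum is
      at most \<open>9/2 * l * \<delta>\<close>, while the block at \<open>p\<close> offers
      \<open>6 * l * \<delta>\<close>.\<close>
    have "(\<Sum>j\<in>S. Q1 (C ! j)) \<le> real (card S0) * (6 * \<delta>) + real (card (S - S0)) * (3 * \<delta>)"
      unfolding split using \<delta> Q2_nonpos
      by (intro add_mono sum_bounded_above) (auto simp: Q1_def S0_def intro: order_trans[OF Q2_nonpos])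
    moreover have "real l * (6 * \<delta>) \<le> real l * Q1 p"
      by (intro mult_left_mono) (auto simp: Q1_def)
    moreover have "real l * Q1 p - (\<Sum>j\<in>S. Q1 (C ! j)) \<le> real l * \<delta>"
      by (rule regret[OF _ pref1]) (simp add: L_def)
    ultimately have "real l * (6 * \<delta>) - (real (card S0) * (6 * \<delta>) + (real l - real (card S0)) * (3 * \<delta>))
        \<le> real l * \<delta>"
      unfolding card_rest by linarith
    then have "(real l * 2 - real (card S0) * 3) * \<delta> \<le> 0" by (simp add: algebra_simps)
    moreover have "real l * 2 - real (card S0) * 3 > 0" using True l by linarith
    ultimately show False using \<delta> by (simp add: mult_le_0_iff)
  next
    case False
    \<comment> \<open>More than half of the picks lose at least \<open>5/2 * \<delta>\<close>
      against a decoy, in total more than \<open>5/4 * l * \<delta>\<close>.\<close>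
    obtain x where x: "x \<in> X" using X by auto
    have Q2_S0: "Q2 (C ! j) \<le> - (5 / 2 * \<delta>)" if "j \<in> S0" for j
    proof -
      have "dist (C ! j) p < 3 * \<delta>" using that unfolding S0_def by simp
      then have "5 / 2 * \<delta> \<le> dist (C ! j) x'" if "x' \<in> X" for x'
        using X_away[OF that] dist_triangle3[of x' p "C ! j"] by linarith
      then show ?thesis using argmin(1) unfolding Q2_def inf_argmin by simp
    qed
    have "(\<Sum>j\<in>S. Q2 (C ! j)) \<le> real (card S0) * (- (5 / 2 * \<delta>)) + real (card (S - S0)) * 0"
      unfolding split using Q2_S0 Q2_nonpos by (intro add_mono sum_bounded_above) auto
    then have "real (card S0) * (5 / 2 * \<delta>) \<le> real l * \<delta>"
      using regret[OF _ pref2, of x] Q2_X[OF x] x unfolding L_def by simp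
    then have "(real (card S0) * 5 / 2 - real l) * \<delta> \<le> 0" by (simp add: algebra_simps)
    moreover have "real (card S0) * 5 / 2 - real l > 0" using False l by linarith
    ultimately show False using \<delta> by (simp add: mult_le_0_iff)
  qed
qed

section \<open>Decoys and packing points\<close>

text \<open>Each \<open>y\<close> in the cover represents nearby directions, and some point of
  \<open>\<Theta>\<close> on the sphere in such a direction, if any, becomes its decoy. Points of
  the sphere sharing a \<open>y\<close> are at most \<open>r / 2\<close> apart.\<close>

lemma sphere_decoys:
  fixes \<Theta> :: "'a::real_normed_vector set" and c :: 'a
  assumes conv: "convex \<Theta>" and p: "p \<in> \<Theta>" and r: "r > 0"
    and Y: "finite Y" "is_cover (cball c 1) (1/4) Y"
  shows "\<exists>X\<subseteq>\<Theta>. finite X \<and> card X \<le> card Y \<and> (\<forall>x\<in>X. dist x p = r) \<and>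
           (\<forall>e\<in>\<Theta>. dist e p \<ge> r \<longrightarrow> (\<exists>x\<in>X. dist e x \<le> dist e p - r / 2))"
proof -
  define Z where "Z y = {z \<in> \<Theta>. dist z p = r \<and> dist ((1 / r) *\<^sub>R (z - p) + c) y \<le> 1 / 4}" for y
  define pick where "pick y = (SOME z. z \<in> Z y)" for y
  have pick: "pick y \<in> Z y" if "z \<in> Z y" for z y
    unfolding pick_def using that by (rule someI)
  define X where "X = pick ` {y \<in> Y. Z y \<noteq> {}}"
  have "\<exists>y. x \<in> Z y" if "x \<in> X" for x
    using that pick unfolding X_def by blast
  then have "X \<subseteq> \<Theta>" "\<forall>x\<in>X. dist x p = r" unfolding Z_def by blast+
  moreover have "finite X" using Y(1) unfolding X_def by simp
  moreover have "card X \<le> card Y"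
  proof -
    have "card X \<le> card {y \<in> Y. Z y \<noteq> {}}"
      unfolding X_def using Y(1) by (intro card_image_le) auto
    also have "\<dots> \<le> card Y" using Y(1) by (intro card_mono) auto
    finally show ?thesis .
  qed
  moreover have "\<exists>x\<in>X. dist e x \<le> dist e p - r / 2" if e: "e \<in> \<Theta>" "dist e p \<ge> r" for e
  proof -
    define t where "t = r / dist e p"
    \<comment> \<open>The segment from \<open>p\<close> to \<open>e\<close> crosses the sphere at
      \<open>z\<close>, which is closer to \<open>e\<close> than \<open>p\<close> by
      \<open>r\<close>; the decoy for its direction gives up at most half of this.\<close>
    define z where "z = p + t *\<^sub>R (e - p)"
    have pos: "dist e p > 0" using e(2) r by linarith
    have t: "0 \<le> t" "t \<le> 1" using e(2) r pos unfolding t_def by auto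
    have "z = (1 - t) *\<^sub>R p + t *\<^sub>R e" unfolding z_def by (simp add: algebra_simps)
    then have z\<Theta>: "z \<in> \<Theta>" using convexD_alt[OF conv p e(1) t] by simp
    have zp: "dist z p = r"
      using t pos r by (simp add: z_def dist_norm t_def)
    have "e - z = (1 - t) *\<^sub>R (e - p)" unfolding z_def by (simp add: algebra_simps)
    then have "dist e z = (1 - t) * dist e p" using t by (simp add: dist_norm)
    then have ez: "dist e z = dist e p - r" using pos by (simp add: t_def algebra_simps)
    have "(1 / r) *\<^sub>R (z - p) + c \<in> cball c 1"
      using zp r by (simp add: dist_norm)
    then obtain y where y: "y \<in> Y" "dist ((1 / r) *\<^sub>R (z - p) + c) y \<le> 1 / 4"
      using Y(2) unfolding is_cover_def by blast
    then have "z \<in> Z y" using z\<Theta> zp unfolding Z_def by simp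
    then have py: "pick y \<in> Z y" "pick y \<in> X" using pick y(1) unfolding X_def by auto
    have "(1 / r) * dist z (pick y) = dist ((1 / r) *\<^sub>R (z - p) + c) ((1 / r) *\<^sub>R (pick y - p) + c)"
      using r by (simp add: dist_norm flip: scaleR_diff_right)
    also have "\<dots> \<le> 1 / 4 + 1 / 4"
      using py(1) y(2) unfolding Z_def by (intro order_trans[OF dist_triangle2[of _ _ y]] add_mono) auto
    finally have "dist z (pick y) \<le> r / 2" using r by (simp add: field_simps)
    then show ?thesis using py(2) ez dist_triangle[of e "pick y" z] by force
  qed
  ultimately show ?thesis by blast
qed

text \<open>Otherwise the diameter would be at most \<open>11 * \<epsilon>\<close>. The constant is
  below 6 because the diameter is a supremum that need not be attained.\<close>

lemma exists_far_point:
  assumes "ediameter \<Theta> \<ge> ereal (12 * \<epsilon>)" "\<epsilon> > 0"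
  shows "\<exists>y\<in>\<Theta>. dist y p \<ge> 11 / 2 * \<epsilon>"
proof (rule ccontr)
  assume "\<not> ?thesis"
  then have near: "dist y p < 11 / 2 * \<epsilon>" if "y \<in> \<Theta>" for y using that by force
  have "dist x y \<le> 11 * \<epsilon>" if "x \<in> \<Theta>" "y \<in> \<Theta>" for x y
    using near[OF that(1)] near[OF that(2)] dist_triangle2[of x y p] by linarith
  then have "ediameter \<Theta> \<le> ereal (11 * \<epsilon>)"
    unfolding ediameter_def by (intro SUP_least) simp
  then have "ereal (12 * \<epsilon>) \<le> ereal (11 * \<epsilon>)" using assms(1) by (rule order_trans[rotated])
  then show False using assms(2) by simp
qed

text \<open>The open balls of radius \<open>12 * \<epsilon> / l\<close> around the packing points are disjoint, so a small
  committee has few experts in one of them.\<close>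

lemma packing_le_committee:
  fixes \<Theta> :: "'a::real_normed_vector set" and c :: 'a
  assumes conv: "convex \<Theta>" and \<epsilon>: "\<epsilon> > 0" and l: "1 \<le> l" "l \<le> k"
    and diam: "ediameter \<Theta> \<ge> ereal (12 * \<epsilon>)"
    and Y: "finite Y" "is_cover (cball c 1) (1/4) Y"
    and m: "k * (card Y + 1) \<le> m"
    and P: "finite P" "is_packing \<Theta> (24 * \<epsilon> / real l) P"
    and f: "f \<in> voting_rules \<Theta> m k l" and E: "set E \<subseteq> \<Theta>"
    and guar: "guarantees_regret \<Theta> m k l f \<epsilon> E"
  shows "real (card P) * (real m / (real k * (real (card Y) + 1)) - 1) \<le> real (length E)"
proof -
  define \<delta> where "\<delta> = \<epsilon> / real l"
  let ?D = "real m / (real k * (real (card Y) + 1)) - 1"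
  let ?A = "\<lambda>p. set E \<inter> ball p (12 * \<delta>)"
  have \<delta>: "\<delta> > 0" "\<epsilon> = real l * \<delta>" "\<delta> \<le> \<epsilon>" using \<epsilon> l by (auto simp: \<delta>_def field_simps)
  have few: "?D \<le> real (card (?A p))" if p: "p \<in> P" for p
  proof (rule ccontr)
    assume "\<not> ?thesis"
    then have "real (card (?A p)) + 1 < real m / (real k * (real (card Y) + 1))" by simp
    moreover have "real k * (real (card Y) + 1) > 0" using l by (intro mult_pos_pos) auto
    ultimately have "(real (card (?A p)) + 1) * (real k * (real (card Y) + 1)) < real m"
      by (simp add: pos_less_divide_eq)
    then have "real ((card (?A p) + 1) * (k * (card Y + 1))) < real m"
      by (simp add: algebra_simps)
    then have lt: "(card (?A p) + 1) * (k * (card Y + 1)) < m" by (simp only: of_nat_less_iff)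
    \<comment> \<open>The sum counts the locations that the adversary occupies: nearby experts,
      decoys and \<open>p\<close>.\<close>
    have "card (?A p) + card Y + 1 \<le> (card (?A p) + 1) * (card Y + 1)"
      by (simp add: algebra_simps)
    then have "(card (?A p) + card Y + 1) * k \<le> (card (?A p) + 1) * (card Y + 1) * k"
      by (rule mult_right_mono) simp
    then have room: "(card (?A p) + card Y + 1) * k \<le> m"
      using lt by (simp add: algebra_simps)
    have p\<Theta>: "p \<in> \<Theta>" using p P unfolding is_packing_def by auto
    obtain X where X: "X \<subseteq> \<Theta>" "finite X" "card X \<le> card Y" "\<forall>x\<in>X. dist x p = 12 * \<delta>"
        "\<forall>e\<in>\<Theta>. dist e p \<ge> 12 * \<delta> \<longrightarrow> (\<exists>x\<in>X. dist e x \<le> dist e p - 12 * \<delta> / 2)"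
      using sphere_decoys[OF conv p\<Theta> _ Y, of "12 * \<delta>"] \<delta> by auto
    obtain y0 where y0: "y0 \<in> \<Theta>" "dist y0 p \<ge> 11 / 2 * \<delta>"
      using exists_far_point[OF diam \<epsilon>, of p] \<delta> by (meson mult_left_mono order_trans zero_le_divide_iff zero_le_numeral)
    have "c \<in> cball c 1" by simp
    then have "Y \<noteq> {}" using Y(2) unfolding is_cover_def by blast
    then have "card Y \<ge> 1" using Y(1) by (simp add: Suc_le_eq card_gt_0_iff)
    \<comment> \<open>If there is no decoy, no point of \<open>\<Theta>\<close> has distance
      \<open>12 * \<delta>\<close> or more from \<open>p\<close>. Then \<open>y0\<close> serves as
      the only decoy, and the condition on distant points is vacuous.\<close>
    define X' where "X' = (if X = {} then {y0} else X)"
    have card_X': "card X' \<le> card Y" using X \<open>card Y \<ge> 1\<close> unfolding X'_def by simp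
    have "\<not> guarantees_regret \<Theta> m k l f (real l * \<delta>) E"
    proof (rule adversary[OF \<delta>(1) l p\<Theta>, of X'])
      show "finite X'" "X' \<noteq> {}" "X' \<subseteq> \<Theta>" using X y0 unfolding X'_def by auto
      show "11 / 2 * \<delta> \<le> dist x p" if "x \<in> X'" for x
        using that X y0 \<delta> unfolding X'_def by (auto split: if_splits)
      show "\<exists>x\<in>X'. dist e x \<le> dist e p - 6 * \<delta>" if "e \<in> \<Theta>" "12 * \<delta> \<le> dist e p" for e
        using X(5) that unfolding X'_def by auto
      have "(card (?A p) + card X' + 1) * k \<le> (card (?A p) + card Y + 1) * k"
        using card_X' by (intro mult_right_mono) auto
      then show "(card (?A p) + card X' + 1) * k \<le> m" using room by linarith
    qed (use f E in auto)
    then show False using guar \<delta>(2) by simp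
  qed
  have disj: "?A p \<inter> ?A p' = {}" if "p \<in> P" "p' \<in> P" "p \<noteq> p'" for p p'
  proof -
    have "dist p p' \<ge> 24 * \<delta>" using P(2) that unfolding is_packing_def \<delta>_def by auto
    then have "\<not> (dist p x < 12 * \<delta> \<and> dist p' x < 12 * \<delta>)" for x
      using dist_triangle2[of p p' x] by linarith
    then show ?thesis by auto
  qed
  have "real (card P) * ?D \<le> (\<Sum>p\<in>P. real (card (?A p)))"
    using few by (intro sum_bounded_below) auto
  also have "\<dots> = real (card (\<Union>p\<in>P. ?A p))"
    using P(1) disj by (subst card_UN_disjoint) auto
  also have "card (\<Union>p\<in>P. ?A p) \<le> card (set E)" by (intro card_mono) auto
  also have "\<dots> \<le> length E" by (rule card_length)
  finally show ?thesis by simp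
qed

section \<open>Passage to extended numbers\<close>

lemma Inf_enat_attained:
  fixes A :: "enat set"
  assumes "Inf A = enat n"
  shows "enat n \<in> A"
proof -
  have "A \<noteq> {}" using assms by (auto simp: top_enat_def)
  then show ?thesis using assms wellorder_InfI by (metis ex_in_conv)
qed

lemma covering_number_attained:
  assumes "covering_number S \<delta> = enat n"
  obtains X where "finite X" "is_cover S \<delta> X" "card X = n"
  using Inf_enat_attained[OF assms[unfolded covering_number_def]] by auto

lemma le_ereal_INF_min_committee_size:
  assumes "\<And>f E. f \<in> voting_rules \<Theta> m k l \<Longrightarrow> set E \<subseteq> \<Theta> \<Longrightarrow> guarantees_regret \<Theta> m k l f \<epsilon> E
             \<Longrightarrow> x \<le> ereal (real (length E))"
  shows "x \<le> ereal_of_enat (INF f \<in> voting_rules \<Theta> m k l. min_committee_size \<Theta> m k l f \<epsilon>)"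
proof (cases "INF f \<in> voting_rules \<Theta> m k l. min_committee_size \<Theta> m k l f \<epsilon>")
  case (enat n)
  then obtain f where f: "f \<in> voting_rules \<Theta> m k l" "min_committee_size \<Theta> m k l f \<epsilon> = enat n"
    using Inf_enat_attained by fastforce
  then obtain E where "set E \<subseteq> \<Theta>" "guarantees_regret \<Theta> m k l f \<epsilon> E" "length E = n"
    using Inf_enat_attained unfolding min_committee_size_def by fastforce
  then show ?thesis using assms f enat by auto
qed simp

text \<open>For \<open>D > 0\<close> the bound forces the packing number to be finite; for
  \<open>D = 0\<close> it may be infinite, but the product is 0.\<close>

lemma packing_number_times_le:
  assumes "D \<ge> 0" and "\<And>P. finite P \<Longrightarrow> is_packing S \<delta> P \<Longrightarrow> real (card P) * D \<le> real n"
  shows "ereal_of_enat (packing_number S \<delta>) * ereal D \<le> ereal (real n)"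
proof (cases "D = 0")
  case True
  then show ?thesis by (simp flip: zero_ereal_def)
next
  case False
  then have D: "D > 0" using assms(1) by simp
  have "card P \<le> nat \<lfloor>real n / D\<rfloor>" if "finite P" "is_packing S \<delta> P" for P
    using assms(2)[OF that] D by (simp add: le_nat_floor pos_le_divide_eq)
  then have "packing_number S \<delta> \<le> enat (nat \<lfloor>real n / D\<rfloor>)"
    unfolding packing_number_def by (intro SUP_least) simp
  then obtain p where p: "packing_number S \<delta> = enat p" "p \<le> nat \<lfloor>real n / D\<rfloor>"
    by (cases "packing_number S \<delta>") auto
  have "real p \<le> real n / D"
    using p(2) D by (simp add: le_nat_iff le_floor_iff)
  then show ?thesis using p(1) D by (simp add: pos_le_divide_eq)
qed

theorem theorem6p1:
  fixes \<Theta> B1 :: "'a::real_normed_vector set" and \<epsilon> :: real and l k m :: nat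
  assumes "\<exists>c. B1 = cball c 1"
    and "\<epsilon> > 0"
    and "convex \<Theta>"
    and "ediameter \<Theta> \<ge> ereal (12 * \<epsilon>)"
    and "1 \<le> l" and "l \<le> k"
    and "enat m \<ge> enat k * (covering_number B1 (1/4) + 1)"
  shows "ereal_of_enat (packing_number \<Theta> (24 * \<epsilon> / real l)) *
           (ereal (real m) / (ereal (real k) * (ereal_of_enat (covering_number B1 (1/4)) + 1)) - 1)
         \<le> ereal_of_enat (INF f \<in> voting_rules \<Theta> m k l. min_committee_size \<Theta> m k l f \<epsilon>)
       \<and> ereal_of_enat (INF f \<in> voting_rules \<Theta> m k l. min_committee_size \<Theta> m k l f \<epsilon>)
         \<le> (if l < k
            then ereal (8 * real m / real l * ln (real k / (real k - real l)) + 1) *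
                   (ereal_of_enat (covering_number \<Theta> (\<epsilon> / (2 * real l))) - 1)
            else ereal (8 * real m / real k * (1 + ln (real k)) + 1) *
                   (ereal_of_enat (covering_number \<Theta> (\<epsilon> / (2 * real l))) - 1))"
proof -
  have k: "k > 0" using assms(5,6) by simp
  obtain c where c: "B1 = cball c 1" using assms(1) by blast
  \<comment> \<open>An infinite covering number would contradict the finite \<open>m\<close>, as
    \<open>k > 0\<close>.\<close>
  obtain N where N: "covering_number B1 (1/4) = enat N"
    using assms(7) k by (cases "covering_number B1 (1/4)") (auto simp: enat_0_iff)
  obtain Y where Y: "finite Y" "is_cover (cball c 1) (1/4) Y" "card Y = N"
    using covering_number_attained N unfolding c by blast
  have "enat k * (enat N + 1) = enat (k * (N + 1))"
    by (simp add: one_enat_def)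
  then have m: "k * (N + 1) \<le> m" using assms(7) unfolding N by simp
  \<comment> \<open>The ball is nonempty, hence \<open>N \<ge> 1\<close> and
    \<open>2 * k \<le> m\<close>, as the upper bound requires.\<close>
  have "c \<in> cball c 1" by simp
  then have "Y \<noteq> {}" using Y(2) unfolding is_cover_def by blast
  then have "N \<ge> 1" using Y by (simp add: Suc_le_eq card_gt_0_iff flip: Y(3))
  then have "k * 2 \<le> k * (N + 1)" by (intro mult_left_mono) auto
  then have m2: "2 * k \<le> m" using m by linarith
  let ?I = "ereal_of_enat (INF f \<in> voting_rules \<Theta> m k l. min_committee_size \<Theta> m k l f \<epsilon>)"
  define D where "D = real m / (real k * (real N + 1)) - 1"
  have pos: "real k * (real N + 1) > 0" using k by (intro mult_pos_pos) auto
  have "real (k * (N + 1)) \<le> real m" using m by (rule of_nat_mono)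
  then have "D \<ge> 0" using pos by (simp add: D_def pos_le_divide_eq algebra_simps)
  have D_eq: "ereal (real m) / (ereal (real k) * (ereal_of_enat (enat N) + 1)) - 1 = ereal D"
    using k by (simp add: D_def one_ereal_def)
  have lower: "ereal_of_enat (packing_number \<Theta> (24 * \<epsilon> / real l)) * ereal D \<le> ?I"
  proof (intro le_ereal_INF_min_committee_size packing_number_times_le[OF \<open>D \<ge> 0\<close>])
    fix f and E :: "'a list" and P
    assume "f \<in> voting_rules \<Theta> m k l" "set E \<subseteq> \<Theta>" "guarantees_regret \<Theta> m k l f \<epsilon> E"
      "finite P" "is_packing \<Theta> (24 * \<epsilon> / real l) P"
    then show "real (card P) * D \<le> real (length E)"
      unfolding D_def Y(3)[symmetric]
      using assms(2-6) Y m by (intro packing_le_committee) auto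
  qed
  have upper: "?I \<le> ereal (8 * real m / real l * H + 1) *
      (ereal_of_enat (covering_number \<Theta> (\<epsilon> / (2 * real l))) - 1)"
    if H: "(\<Sum>i<l. 1 / real (k - i)) \<le> H" for H
  proof (cases "covering_number \<Theta> (\<epsilon> / (2 * real l))")
    \<comment> \<open>The factor in front is positive, so the right-hand side is infinite.\<close>
    case infinity
    have "0 \<le> H" using H by (meson order_trans sum_nonneg of_nat_0_le_iff zero_le_divide_1_iff)
    then have "0 < 8 * real m / real l * H + 1" by (intro add_nonneg_pos mult_nonneg_nonneg) auto
    then show ?thesis using infinity by simp
  next
    case (enat N')
    then obtain X where X: "finite X" "is_cover \<Theta> (\<epsilon> / (2 * real l)) X" "card X = N'"
      using covering_number_attained by blast
    \<comment> \<open>A single point covers only radius \<open>\<epsilon> / 2\<close>, too little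
      for the diameter of \<open>\<Theta>\<close>.\<close>
    have "2 \<le> card X"
    proof (rule ccontr)
      assume "\<not> 2 \<le> card X"
      then have "\<forall>a\<in>X. \<forall>b\<in>X. a = b" using card_le_Suc0_iff_eq[OF X(1)] by simp
      then obtain x where x: "X \<subseteq> {x}" by (cases "X = {}") blast+
      obtain y where y: "y \<in> \<Theta>" "11 / 2 * \<epsilon> \<le> dist y x"
        using exists_far_point[OF assms(4,2)] by blast
      then have "dist y x \<le> \<epsilon> / (2 * real l)" using X(2) x unfolding is_cover_def by blast
      also have "\<dots> \<le> \<epsilon> / 2" using assms(2,5) by (intro divide_left_mono) auto
      finally show False using y(2) assms(2) by linarith
    qed
    then obtain f E where fE: "f \<in> voting_rules \<Theta> m k l" "set E \<subseteq> \<Theta>" "guarantees_regret \<Theta> m k l f \<epsilon> E"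
        "real (length E) \<le> (8 * real m / real l * H + 1) * (real (card X) - 1)"
      using committee_from_cover[OF assms(3,2,5,6) m2 X(1,2) _ H] by blast
    have "(INF f \<in> voting_rules \<Theta> m k l. min_committee_size \<Theta> m k l f \<epsilon>) \<le> enat (length E)"
      unfolding min_committee_size_def using fE by (intro INF_lower2[of f] INF_lower2[of E]) auto
    then have "?I \<le> ereal_of_enat (enat (length E))" by (simp only: ereal_of_enat_le_iff)
    also have "\<dots> \<le> ereal ((8 * real m / real l * H + 1) * (real (card X) - 1))"
      using fE(4) by simp
    finally show ?thesis using enat X(3) by (simp add: one_ereal_def)
  qed
  show ?thesis
  proof (cases "l < k")
    case True
    then show ?thesis
      using lower upper[OF sum_reciprocals_le_ln[OF True]] unfolding N D_eq by simp
  next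
    case False
    then have "l = k" using assms(6) by simp
    then show ?thesis
      using lower upper sum_reciprocals_le_ln_self[OF k] unfolding N D_eq by simp
  qed
qed

end
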